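(* Let $\mathbb{P}$ be an $r$-rectangular uncertainty set. Assume that the sets $\mathcal{W}^1,\dots,\mathcal{W}^r$ have finitely many extreme points. Then there exist a stationary deterministic policy $\pi^*$, a factor matrix $W^*\in\mathcal{W}$, and a discount factor $\lambda_0\in(0,1)$ such that for all $\lambda\in(\lambda_0,1)$ the pair $(\pi^*,W^* )$ is an optimal solution to the robust MDP problem $$\max_{\pi\in\Pi^G}\min_{W\in\mathcal{W}}R(\pi,W,\lambda).$$
   Context: MDP setting: finite state set $\mathcal{S}$, $|\mathcal{S}|=S$; finite action set $\mathcal{A}$, $|\mathcal{A}|=A$; rewards $r_{sa}\ge0$; initial probability distribution $p_0$ on $\mathcal{S}$. $\Pi^G$ is the set of all (possibly history-dependent, randomized) policies. A policy is stationary if the action distribution depends only on the current state, and deterministic if that distribution puts mass one on a single action. $r$-rectangular uncertainty set: fix an integer $r\ge1$, coefficients $u^i_{sa}\ge0$ with $\sum_{i=1}^r u^i_{sa}=1$ for all $(s,a)$, and (nonempty) convex compact sets $\mathcal{W}^1,\dots,\mathcal{W}^r$ of probability vectors in $\mathbb{R}^S_+$; put $\mathcal{W}=\mathcal{W}^1\times\dots\times\mathcal{W}^r$. Each $W=(w_1,\dots,w_r)\in\mathcal{W}$ determines the kernel $P_{sas'}=\sum_{i=1}^r u^i_{sa}w_{i,s'}$, and $\mathbb{P}$ is the set of all these kernels. For $\lambda\in(0,1)$, $R(\pi,W,\lambda)=\mathbb{E}^{\pi,P}\big[\sum_{t\ge0}\lambda^t r_{s_ta_t}\mid s_0\sim p_0\big]$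 with $P$ the kernel determined by $W$. A pair $(\pi^*,W^* )$ is an optimal solution to the robust MDP problem with discount factor $\lambda$ if $\pi^*$ attains $\max_{\pi\in\Pi^G}\min_{W\in\mathcal{W}}R(\pi,W,\lambda)$ and $W^*\in\arg\min_{W\in\mathcal{W}}R(\pi^*,W,\lambda)$. *)

theory Defs
  imports "HOL-Probability.Probability"
begin

(* A history-dependent randomized policy maps the past state-action pairs (oldest first)
   and the current state to a distribution over actions.  All such maps are admissible. *)
type_synonym ('s, 'a) policy = "('s \<times> 'a) list \<Rightarrow> 's \<Rightarrow> 'a pmf"

type_synonym ('s, 'a) kernel = "'s \<Rightarrow> 'a \<Rightarrow> 's pmf"

definition stationary :: "('s, 'a) policy \<Rightarrow> bool" where
  "stationary \<pi> \<longleftrightarrow> (\<exists>d. \<forall>h s. \<pi> h s = d s)"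

definition deterministic :: "('s, 'a) policy \<Rightarrow> bool" where
  "deterministic \<pi> \<longleftrightarrow> (\<forall>h s. \<exists>a. pmf (\<pi> h s) a = 1)"


subsection \<open>Trajectories and discounted return\<close>

(* Conditional law of (s_t, a_t), where \<omega> i = (s_i, a_i); only the values \<omega> i with i < t are used. *)
definition step :: "'s pmf \<Rightarrow> ('s, 'a) kernel \<Rightarrow> ('s, 'a) policy \<Rightarrow> nat \<Rightarrow> (nat \<Rightarrow> 's \<times> 'a) \<Rightarrow> ('s \<times> 'a) measure" where
  "step p0 P \<pi> t \<omega> = measure_pmf
     (bind_pmf (case t of 0 \<Rightarrow> p0 | Suc i \<Rightarrow> P (fst (\<omega> i)) (snd (\<omega> i)))
       (\<lambda>s. map_pmf (\<lambda>a. (s, a)) (\<pi> (map \<omega> [0..<t]) s)))"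

(* The locale provides the existence of the infinite-horizon law. *)
lemma Ionescu_Tulcea_step:
  fixes p0 :: "'s :: finite pmf" and P :: "('s, 'a :: finite) kernel" and \<pi> :: "('s, 'a) policy"
  shows "Ionescu_Tulcea (step p0 P \<pi>) (\<lambda>_. count_space UNIV)"
proof (rule Ionescu_Tulcea.intro)
  fix t :: nat
  have eq: "PiM {0..<t} (\<lambda>_. count_space (UNIV :: ('s \<times> 'a) set)) = count_space (PiE {0..<t} (\<lambda>_. UNIV))"
    using count_space_PiM_finite[of "{0..<t}" "\<lambda>_. UNIV :: ('s \<times> 'a) set"] by simp
  show "step p0 P \<pi> t \<in> measurable (PiM {0..<t} (\<lambda>_. count_space UNIV)) (subprob_algebra (count_space UNIV))"
    unfolding eq by (auto simp: step_def space_subprob_algebra intro: measure_pmf.subprob_space_axioms)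
  show "prob_space (step p0 P \<pi> t x)" for x :: "nat \<Rightarrow> 's \<times> 'a"
    unfolding step_def by (rule measure_pmf.prob_space_axioms)
qed

(* The law of the process (s_t, a_t) on infinite trajectories. *)
definition trajectory_measure :: "'s :: finite pmf \<Rightarrow> ('s, 'a :: finite) kernel \<Rightarrow> ('s, 'a) policy \<Rightarrow> (nat \<Rightarrow> 's \<times> 'a) measure" where
  "trajectory_measure p0 P \<pi> =
     projective_family.lim UNIV
       (Ionescu_Tulcea.CI (step p0 P \<pi>) (\<lambda>_. count_space UNIV)) (\<lambda>_. count_space UNIV)"

lemma prob_space_trajectory_measure: "prob_space (trajectory_measure p0 P \<pi>)"
proof -
  interpret Ionescu_Tulcea "step p0 P \<pi>" "\<lambda>_. count_space UNIV"
    by (rule Ionescu_Tulcea_step)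
  have "emeasure (trajectory_measure p0 P \<pi>) (PF.emb UNIV {} (space (PiM {} (\<lambda>_. count_space UNIV)))) = emeasure (CI {}) (space (PiM {} (\<lambda>_. count_space UNIV)))"
    unfolding trajectory_measure_def by (rule lim) auto
  moreover have "PF.emb UNIV {} (space (PiM {} (\<lambda>_. count_space UNIV))) = space (trajectory_measure p0 P \<pi>)"
    unfolding trajectory_measure_def PF.space_lim by (auto simp: prod_emb_def space_PiM)
  moreover have "emeasure (CI {}) (space (PiM {} (\<lambda>_. count_space UNIV))) = 1"
    using prob_space.emeasure_space_1[OF PF.prob_space_P[of "{}"]] by (simp add: CI_def)
  ultimately show ?thesis
    by (intro prob_spaceI) simp
qed

definition discounted_return ::
  "('s :: finite \<Rightarrow> 'a :: finite \<Rightarrow> real) \<Rightarrow> 's pmf \<Rightarrow> ('s, 'a) kernel \<Rightarrow> ('s, 'a) policy \<Rightarrow> real \<Rightarrow> real" where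
  "discounted_return rew p0 P \<pi> lam =
     (\<integral>\<omega>. (\<Sum>t. lam ^ t * rew (fst (\<omega> t)) (snd (\<omega> t))) \<partial>trajectory_measure p0 P \<pi>)"


subsection \<open>Factor matrices and r-rectangular uncertainty sets\<close>

(* The integer r is CARD('r); a factor matrix is the family of its columns w_i, i :: 'r. *)
type_synonym ('s, 'r) factor = "'r \<Rightarrow> real ^ 's"

definition prob_vectors :: "(real ^ 's) set" where
  "prob_vectors = {w. (\<forall>s. 0 \<le> w $ s) \<and> (\<Sum>s\<in>UNIV. w $ s) = 1}"

definition factor_set :: "('r \<Rightarrow> (real ^ 's) set) \<Rightarrow> ('s, 'r) factor set" where
  "factor_set Ws = {W. \<forall>i. W i \<in> Ws i}"

definition factor_kernel ::
  "('r :: finite \<Rightarrow> 's :: finite \<Rightarrow> 'a \<Rightarrow> real) \<Rightarrow> ('s, 'r) factor \<Rightarrow> ('s, 'a) kernel" where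
  "factor_kernel u W s a = embed_pmf (\<lambda>s'. \<Sum>i\<in>UNIV. u i s a * W i $ s')"

definition r_rectangular ::
  "('r :: finite \<Rightarrow> 's :: finite \<Rightarrow> 'a \<Rightarrow> real) \<Rightarrow> ('r \<Rightarrow> (real ^ 's) set) \<Rightarrow> ('s, 'a) kernel set \<Rightarrow> bool" where
  "r_rectangular u Ws \<P> \<longleftrightarrow>
     (\<forall>i s a. 0 \<le> u i s a) \<and> (\<forall>s a. (\<Sum>i\<in>UNIV. u i s a) = 1) \<and>
     (\<forall>i. Ws i \<noteq> {} \<and> convex (Ws i) \<and> compact (Ws i) \<and> Ws i \<subseteq> prob_vectors) \<and>
     \<P> = factor_kernel u ` factor_set Ws"

(* embed_pmf is only meaningful for probability mass functions; this is always the case here. *)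
lemma pmf_factor_kernel:
  assumes "r_rectangular u Ws \<P>" and "W \<in> factor_set Ws"
  shows "pmf (factor_kernel u W s a) s' = (\<Sum>i\<in>UNIV. u i s a * W i $ s')"
proof -
  have u: "\<And>i. 0 \<le> u i s a" "(\<Sum>i\<in>UNIV. u i s a) = 1"
    and w: "\<And>i s. 0 \<le> W i $ s" "\<And>i. (\<Sum>s\<in>UNIV. W i $ s) = 1"
    using assms unfolding r_rectangular_def factor_set_def prob_vectors_def by blast+
  have nn: "0 \<le> (\<Sum>i\<in>UNIV. u i s a * W i $ x)" for x
    by (intro sum_nonneg mult_nonneg_nonneg u w)
  have "(\<Sum>x\<in>UNIV. \<Sum>i\<in>UNIV. u i s a * W i $ x) = 1"
    by (subst sum.swap) (simp add: sum_distrib_left[symmetric] u w)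
  then show ?thesis
    unfolding factor_kernel_def
    by (intro pmf_embed_pmf nn) (simp add: nn_integral_count_space_finite sum_ennreal nn)
qed


subsection \<open>The robust MDP problem\<close>

definition R ::
  "('s :: finite \<Rightarrow> 'a :: finite \<Rightarrow> real) \<Rightarrow> 's pmf \<Rightarrow> ('r :: finite \<Rightarrow> 's \<Rightarrow> 'a \<Rightarrow> real) \<Rightarrow>
    ('s, 'a) policy \<Rightarrow> ('s, 'r) factor \<Rightarrow> real \<Rightarrow> real" where
  "R rew p0 u \<pi> W lam = discounted_return rew p0 (factor_kernel u W) \<pi> lam"

(* The first conjunct says that the inner minimum is attained for every policy, so that
   the infimum in the second one is a minimum. *)
definition attains_max_min ::
  "('s :: finite \<Rightarrow> 'a :: finite \<Rightarrow> real) \<Rightarrow> 's pmf \<Rightarrow> ('r :: finite \<Rightarrow> 's \<Rightarrow> 'a \<Rightarrow> real) \<Rightarrow>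
    ('s, 'r) factor set \<Rightarrow> real \<Rightarrow> ('s, 'a) policy \<Rightarrow> bool" where
  "attains_max_min rew p0 u WW lam \<pi>\<^sub>0 \<longleftrightarrow>
     (\<forall>\<pi>. \<exists>W. is_arg_min (\<lambda>W. R rew p0 u \<pi> W lam) (\<lambda>W. W \<in> WW) W) \<and>
     is_arg_max (\<lambda>\<pi>. INF W\<in>WW. R rew p0 u \<pi> W lam) (\<lambda>_. True) \<pi>\<^sub>0"

definition robust_optimal ::
  "('s :: finite \<Rightarrow> 'a :: finite \<Rightarrow> real) \<Rightarrow> 's pmf \<Rightarrow> ('r :: finite \<Rightarrow> 's \<Rightarrow> 'a \<Rightarrow> real) \<Rightarrow>
    ('s, 'r) factor set \<Rightarrow> real \<Rightarrow> ('s, 'a) policy \<Rightarrow> ('s, 'r) factor \<Rightarrow> bool" where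
  "robust_optimal rew p0 u WW lam \<pi>\<^sub>0 W\<^sub>0 \<longleftrightarrow>
     attains_max_min rew p0 u WW lam \<pi>\<^sub>0 \<and>
     is_arg_min (\<lambda>W. R rew p0 u \<pi>\<^sub>0 W lam) (\<lambda>W. W \<in> WW) W\<^sub>0"

end

theory Submission
  imports Defs
begin

text \<open>
  If \<open>v\<close> solves the robust Bellman equation, a maximising action in every state together with a
  minimising column for every factor is a saddle point of the return: against the fixed columns
  \<open>v\<close> bounds the return of every policy from above, and with the fixed actions it bounds the
  return of every factor matrix from below.  The columns can be chosen among the extreme points,
  so only finitely many pairs occur.  By Cramer's rule the value of a fixed pair is a rational
  function of the discount factor, so whether the pair solves the Bellman equation does not change
  any more close to \<open>1\<close>.  As some pair solves it for every discount factor, one of them does so for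
  all discount factors close to \<open>1\<close>.
\<close>

subsection \<open>The law of the state-action process\<close>

definition next_state :: "'s pmf \<Rightarrow> ('s, 'a) kernel \<Rightarrow> ('s \<times> 'a) list \<Rightarrow> 's pmf" where
  "next_state p0 P h = (if h = [] then p0 else P (fst (last h)) (snd (last h)))"

definition next_pair ::
  "'s pmf \<Rightarrow> ('s, 'a) kernel \<Rightarrow> ('s, 'a) policy \<Rightarrow> ('s \<times> 'a) list \<Rightarrow> ('s \<times> 'a) pmf" where
  "next_pair p0 P \<pi> h = bind_pmf (next_state p0 P h) (\<lambda>s. map_pmf (Pair s) (\<pi> h s))"

primrec history_pmf ::
  "'s pmf \<Rightarrow> ('s, 'a) kernel \<Rightarrow> ('s, 'a) policy \<Rightarrow> nat \<Rightarrow> ('s \<times> 'a) list pmf" where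
  "history_pmf p0 P \<pi> 0 = return_pmf []"
| "history_pmf p0 P \<pi> (Suc t) =
     bind_pmf (history_pmf p0 P \<pi> t) (\<lambda>h. map_pmf (\<lambda>x. h @ [x]) (next_pair p0 P \<pi> h))"

definition state_action_pmf ::
  "'s pmf \<Rightarrow> ('s, 'a) kernel \<Rightarrow> ('s, 'a) policy \<Rightarrow> nat \<Rightarrow> ('s \<times> 'a) pmf" where
  "state_action_pmf p0 P \<pi> t = bind_pmf (history_pmf p0 P \<pi> t) (next_pair p0 P \<pi>)"

lemma step_eq_next_pair: "step p0 P \<pi> t \<omega> = measure_pmf (next_pair p0 P \<pi> (map \<omega> [0..<t]))"
  by (cases t) (simp_all add: step_def next_pair_def next_state_def)

lemma nn_integral_history:
  fixes p0 :: "'s :: finite pmf" and P :: "('s, 'a :: finite) kernel"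
  shows "(\<integral>\<^sup>+\<omega>. f (map \<omega> [0..<n]) \<partial>Ionescu_Tulcea.C (step p0 P \<pi>) (\<lambda>_. count_space UNIV) 0 n (\<lambda>_. undefined))
    = (\<integral>\<^sup>+h. f h \<partial>measure_pmf (history_pmf p0 P \<pi> n))"
proof (induction n arbitrary: f)
  interpret Ionescu_Tulcea "step p0 P \<pi>" "\<lambda>_. count_space UNIV"
    by (rule Ionescu_Tulcea_step)
  have sp: "(\<lambda>_. undefined) \<in> space (PiM {0..<0::nat} (\<lambda>_. count_space (UNIV :: ('s \<times> 'a) set)))"
    by (simp add: space_PiM)
  {
    case 0
    show ?case using sp by (simp add: nn_integral_return)
  next
    case (Suc n)
    have meas: "g \<in> borel_measurable (PiM {0..<m} (\<lambda>_. count_space UNIV))" for g :: "(nat \<Rightarrow> 's \<times> 'a) \<Rightarrow> ennreal" and m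
    proof -
      have eq: "PiM {0..<m} (\<lambda>_. count_space (UNIV :: ('s \<times> 'a) set)) = count_space (PiE {0..<m} (\<lambda>_. UNIV))"
        using count_space_PiM_finite[of "{0..<m}" "\<lambda>_. UNIV :: ('s \<times> 'a) set"] by simp
      show ?thesis unfolding eq by simp
    qed
    have "(\<integral>\<^sup>+\<omega>. f (map \<omega> [0..<Suc n]) \<partial>C 0 (Suc n) (\<lambda>_. undefined)) =
        (\<integral>\<^sup>+\<omega>. \<integral>\<^sup>+\<omega>'. f (map \<omega>' [0..<Suc n]) \<partial>eP n \<omega> \<partial>C 0 n (\<lambda>_. undefined))"
    proof -
      have "eP n \<in> measurable (C 0 n (\<lambda>_. undefined)) (subprob_algebra (PiM {0..<Suc n} (\<lambda>_. count_space UNIV)))"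
        using measurable_eP[of n] by (simp add: measurable_cong_sets[OF sets_C[OF sp, of n] refl])
      then show ?thesis
        by (simp del: upt_Suc) (rule nn_integral_bind[OF meas[where m="Suc n"]])
    qed
    also have "\<dots> = (\<integral>\<^sup>+\<omega>. \<integral>\<^sup>+x. f (map \<omega> [0..<n] @ [x]) \<partial>next_pair p0 P \<pi> (map \<omega> [0..<n]) \<partial>C 0 n (\<lambda>_. undefined))"
    proof (rule nn_integral_cong)
      fix \<omega> assume "\<omega> \<in> space (C 0 n (\<lambda>_. undefined))"
      then have \<omega>: "\<omega> \<in> space (PiM {0..<n} (\<lambda>_. count_space UNIV))" 
        using space_C[OF sp, of n] by simp
      have eq: "map (fun_upd \<omega> n x) [0..<n] = map \<omega> [0..<n]" for x by simp
      show "(\<integral>\<^sup>+\<omega>'. f (map \<omega>' [0..<Suc n]) \<partial>eP n \<omega>) =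
        (\<integral>\<^sup>+x. f (map \<omega> [0..<n] @ [x]) \<partial>next_pair p0 P \<pi> (map \<omega> [0..<n]))"
        by (subst nn_integral_eP[OF \<omega> meas]) (simp add: step_eq_next_pair eq del: map_fun_upd)
    qed
    also have "\<dots> = (\<integral>\<^sup>+h. \<integral>\<^sup>+x. f (h @ [x]) \<partial>next_pair p0 P \<pi> h \<partial>history_pmf p0 P \<pi> n)"
      by (rule Suc.IH)
    finally show ?case
      by (simp add: nn_integral_map_pmf)
  }
qed

lemma sets_trajectory_measure:
  fixes p0 :: "'s :: finite pmf" and P :: "('s, 'a :: finite) kernel"
  shows "sets (trajectory_measure p0 P \<pi>) = sets (PiM UNIV (\<lambda>_. count_space UNIV))"
proof -
  interpret Ionescu_Tulcea "step p0 P \<pi>" "\<lambda>_. count_space UNIV"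
    by (rule Ionescu_Tulcea_step)
  show ?thesis by (simp add: trajectory_measure_def)
qed

lemma measurable_trajectory_component:
  fixes p0 :: "'s :: finite pmf" and P :: "('s, 'a :: finite) kernel"
  shows "(\<lambda>\<omega>. \<omega> t) \<in> measurable (trajectory_measure p0 P \<pi>) (count_space UNIV)"
  unfolding measurable_cong_sets[OF sets_trajectory_measure refl]
  by (rule measurable_component_singleton[where M="\<lambda>_. count_space UNIV"]) simp

lemma distr_trajectory_measure:
  fixes p0 :: "'s :: finite pmf" and P :: "('s, 'a :: finite) kernel"
  shows "distr (trajectory_measure p0 P \<pi>) (count_space UNIV) (\<lambda>\<omega>. \<omega> t) =
    measure_pmf (state_action_pmf p0 P \<pi> t)"
proof (rule measure_eqI)
  interpret Ionescu_Tulcea "step p0 P \<pi>" "\<lambda>_. count_space UNIV"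
    by (rule Ionescu_Tulcea_step)
  let ?M = "\<lambda>_::nat. count_space (UNIV :: ('s \<times> 'a) set)"
  let ?J = "{0..<Suc t}"
  note m = measurable_trajectory_component[of t p0 P \<pi>]
  have mJ: "(\<lambda>\<omega>. \<omega> t) \<in> measurable (PiM ?J ?M) (count_space UNIV)"
    by (rule measurable_component_singleton[where M="?M"]) simp
  have mr: "(\<lambda>\<omega>. restrict \<omega> ?J) \<in> measurable (trajectory_measure p0 P \<pi>) (PiM ?J ?M)"
    unfolding measurable_cong_sets[OF sets_trajectory_measure refl]
    by (rule measurable_restrict_subset) simp
  have up: "up_to ?J = Suc t"
    by (rule antisym) (simp_all add: up_to_iff, metis Suc_leI atLeast0LessThan finite_atLeastLessThan lessI lessThan_iff up_to_less)
  have sp: "(\<lambda>_. undefined) \<in> space (PiM {0..<0} ?M)"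
    by (simp add: space_PiM)
  have mr': "(\<lambda>\<omega>. restrict \<omega> ?J) \<in> measurable (C 0 (Suc t) (\<lambda>_. undefined)) (PiM ?J ?M)"
    unfolding measurable_cong_sets[OF sets_C[OF sp, of "Suc t"] refl]
    by (rule measurable_restrict_subset) simp
  fix A assume "A \<in> sets (distr (trajectory_measure p0 P \<pi>) (count_space UNIV) (\<lambda>\<omega>. \<omega> t))"
  have "emeasure (distr (trajectory_measure p0 P \<pi>) (count_space UNIV) (\<lambda>\<omega>. \<omega> t)) A =
      (\<integral>\<^sup>+x. indicator A x \<partial>distr (trajectory_measure p0 P \<pi>) (count_space UNIV) (\<lambda>\<omega>. \<omega> t))"
    by simp
  also have "\<dots> = (\<integral>\<^sup>+\<omega>. indicator A (\<omega> t) \<partial>trajectory_measure p0 P \<pi>)"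
    by (rule nn_integral_distr[OF m]) simp
  also have "\<dots> = (\<integral>\<^sup>+\<omega>. indicator A (\<omega> t) \<partial>distr (trajectory_measure p0 P \<pi>) (PiM ?J ?M) (\<lambda>\<omega>. restrict \<omega> ?J))"
    using measurable_compose[OF mJ]
    by (subst nn_integral_distr[OF mr]) simp_all
  also have "\<dots> = (\<integral>\<^sup>+\<omega>. indicator A (\<omega> t) \<partial>CI ?J)"
    unfolding trajectory_measure_def by (subst distr_lim) simp_all
  also have "\<dots> = (\<integral>\<^sup>+\<omega>. indicator A (\<omega> t) \<partial>C 0 (Suc t) (\<lambda>_. undefined))"
    unfolding CI_def up using measurable_compose[OF mJ]
    by (subst nn_integral_distr[OF mr']) (simp_all del: C.simps)
  also have "\<dots> = (\<integral>\<^sup>+\<omega>. indicator A (last (map \<omega> [0..<Suc t])) \<partial>C 0 (Suc t) (\<lambda>_. undefined))"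
    by simp
  also have "\<dots> = (\<integral>\<^sup>+h. indicator A (last h) \<partial>history_pmf p0 P \<pi> (Suc t))"
    by (rule nn_integral_history)
  also have "\<dots> = (\<integral>\<^sup>+x. indicator A x \<partial>state_action_pmf p0 P \<pi> t)"
    by (simp add: state_action_pmf_def del: nn_integral_indicator)
  finally show "emeasure (distr (trajectory_measure p0 P \<pi>) (count_space UNIV) (\<lambda>\<omega>. \<omega> t)) A =
      emeasure (measure_pmf (state_action_pmf p0 P \<pi> t)) A"
    by simp
qed simp

lemma discounted_return_sums:
  fixes p0 :: "'s :: finite pmf" and P :: "('s, 'a :: finite) kernel"
  assumes lam: "0 \<le> lam" "lam < 1"
  shows "(\<lambda>t. lam ^ t * measure_pmf.expectation (state_action_pmf p0 P \<pi> t) (\<lambda>x. rew (fst x) (snd x)))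
    sums discounted_return rew p0 P \<pi> lam"
proof -
  let ?T = "trajectory_measure p0 P \<pi>"
  let ?f = "\<lambda>x. rew (fst x) (snd x)"
  interpret prob_space ?T by (rule prob_space_trajectory_measure)
  note m = measurable_trajectory_component[of _ p0 P \<pi>]
  obtain B where B: "\<And>x. \<bar>?f x\<bar> \<le> B"
    by (rule that[of "Max (range (\<lambda>x. \<bar>?f x\<bar>))"]) simp
  have bnd: "\<bar>lam ^ t * ?f x\<bar> \<le> lam ^ t * B" for t x
    using B lam by (simp add: abs_mult mult_left_mono)
  have sB: "summable (\<lambda>t. lam ^ t * B)"
    using lam by (intro summable_mult2 summable_geometric) simp
  have int: "integrable ?T (\<lambda>\<omega>. lam ^ t * ?f (\<omega> t))" for t
    using measurable_compose[OF m, of ?f borel] bnd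
    by (intro integrable_const_bound[of _ "lam ^ t * B"]) auto
  have le: "(\<integral>\<omega>. norm (lam ^ t * ?f (\<omega> t)) \<partial>?T) \<le> lam ^ t * B" for t
    using int[of t] bnd[of t] by (intro integral_le_const) (auto intro: integrable_norm)
  have "(\<lambda>t. \<integral>\<omega>. lam ^ t * ?f (\<omega> t) \<partial>?T) sums (\<integral>\<omega>. (\<Sum>t. lam ^ t * ?f (\<omega> t)) \<partial>?T)"
  proof (rule sums_integral[OF int])
    show "AE \<omega> in ?T. summable (\<lambda>t. norm (lam ^ t * ?f (\<omega> t)))"
      using bnd by (intro AE_I2 summable_comparison_test'[OF sB]) simp
    show "summable (\<lambda>t. \<integral>\<omega>. norm (lam ^ t * ?f (\<omega> t)) \<partial>?T)"
      using le by (intro summable_comparison_test'[OF sB, of 0]) simp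
  qed
  moreover have "(\<integral>\<omega>. ?f (\<omega> t) \<partial>?T) = measure_pmf.expectation (state_action_pmf p0 P \<pi> t) ?f" for t
    by (simp add: distr_trajectory_measure[symmetric] integral_distr[OF m])
  ultimately show ?thesis
    unfolding discounted_return_def by simp
qed

lemma set_pmf_history_subset:
  fixes p0 :: "'s :: finite pmf" and P :: "('s, 'a :: finite) kernel"
  shows "set_pmf (history_pmf p0 P \<pi> t) \<subseteq> {h. length h = t}"
  by (induction t) auto

lemma finite_histories: "finite {h :: ('s :: finite \<times> 'a :: finite) list. length h = t}"
  using finite_lists_length_eq[of "UNIV :: ('s \<times> 'a) set" t] by simp

lemma map_fst_next_pair: "map_pmf fst (next_pair p0 P \<pi> h) = next_state p0 P h"
  by (simp add: next_pair_def map_bind_pmf pmf.map_comp comp_def bind_return_pmf')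

lemma map_fst_state_action_0: "map_pmf fst (state_action_pmf p0 P \<pi> 0) = p0"
  by (simp add: state_action_pmf_def bind_return_pmf map_fst_next_pair next_state_def)

lemma map_fst_state_action_Suc:
  "map_pmf fst (state_action_pmf p0 P \<pi> (Suc t)) =
    bind_pmf (state_action_pmf p0 P \<pi> t) (\<lambda>x. P (fst x) (snd x))"
  by (simp add: state_action_pmf_def map_bind_pmf bind_map_pmf bind_assoc_pmf map_fst_next_pair)
    (simp add: next_state_def)

lemma expectation_bind_finite:
  fixes M :: "'x :: finite pmf" and N :: "'x \<Rightarrow> 'y :: finite pmf" and f :: "'y \<Rightarrow> real"
  shows "measure_pmf.expectation (bind_pmf M N) f =
    measure_pmf.expectation M (\<lambda>x. measure_pmf.expectation (N x) f)"
  by (subst pmf_expectation_bind[of UNIV]) (auto simp: integral_measure_pmf[of UNIV])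

lemma expectation_finite_le:
  fixes M :: "'x :: finite pmf" and f :: "'x \<Rightarrow> real"
  assumes "\<And>x. x \<in> set_pmf M \<Longrightarrow> f x \<le> g x"
  shows "measure_pmf.expectation M f \<le> measure_pmf.expectation M g"
  by (rule integral_mono_AE) (auto simp: AE_measure_pmf_iff assms intro: integrable_measure_pmf_finite)

subsection \<open>Bounds and continuity of the discounted return\<close>

lemma discounted_return_telescope:
  fixes p0 :: "'s :: finite pmf" and P :: "('s, 'a :: finite) kernel" and v :: "'s \<Rightarrow> real"
  assumes lam: "0 \<le> lam" "lam < 1"
  shows "discounted_return (\<lambda>s a. rew s a + lam * measure_pmf.expectation (P s a) v - v s) p0 P \<pi> lam =
    discounted_return rew p0 P \<pi> lam - measure_pmf.expectation p0 v"
proof -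
  define E where "E t f = measure_pmf.expectation (state_action_pmf p0 P \<pi> t) f" for t and f :: "'s \<times> 'a \<Rightarrow> real"
  define a where "a t = lam ^ t * E t (\<lambda>x. v (fst x))" for t
  obtain B where B: "\<And>s. \<bar>v s\<bar> \<le> B"
    by (rule that[of "Max (range (\<lambda>s. \<bar>v s\<bar>))"]) simp
  have EB: "\<bar>E t (\<lambda>x. v (fst x))\<bar> \<le> B" for t
  proof -
    have "E t (\<lambda>x. v (fst x)) \<le> E t (\<lambda>x. B)" "E t (\<lambda>x. - B) \<le> E t (\<lambda>x. v (fst x))"
      unfolding E_def using B by (intro expectation_finite_le; simp add: abs_le_iff minus_le_iff)+
    then show ?thesis by (simp add: E_def)
  qed
  have "a \<longlonglongrightarrow> 0"
  proof (rule Lim_null_comparison)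
    have "norm (a t) \<le> B * lam ^ t" for t
    proof -
      have "\<bar>E t (\<lambda>x. v (fst x))\<bar> * lam ^ t \<le> B * lam ^ t"
        using lam by (intro mult_right_mono EB) simp
      then show ?thesis using lam by (simp add: a_def abs_mult mult.commute)
    qed
    then show "\<forall>\<^sub>F t in sequentially. norm (a t) \<le> B * lam ^ t"
      by (intro always_eventually allI)
    show "(\<lambda>t. B * lam ^ t) \<longlonglongrightarrow> 0"
      using lam by (intro tendsto_mult_right_zero LIMSEQ_realpow_zero)
  qed
  then have "(\<lambda>t. a (Suc t) - a t) sums (0 - a 0)"
    by (rule telescope_sums)
  from sums_add[OF discounted_return_sums[OF lam, of p0 P \<pi> rew] this]
  have "(\<lambda>t. lam ^ t * E t (\<lambda>x. rew (fst x) (snd x)) + (a (Suc t) - a t)) sums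
    (discounted_return rew p0 P \<pi> lam - a 0)"
    by (simp add: E_def)
  moreover have "a 0 = measure_pmf.expectation p0 v"
    using integral_map_pmf[of fst "state_action_pmf p0 P \<pi> 0" v]
    by (simp add: a_def E_def map_fst_state_action_0)
  moreover have "a (Suc t) = lam ^ t * E t (\<lambda>x. lam * measure_pmf.expectation (P (fst x) (snd x)) v)" for t
    using integral_map_pmf[of fst "state_action_pmf p0 P \<pi> (Suc t)" v]
    by (simp add: a_def E_def map_fst_state_action_Suc expectation_bind_finite)
  then have "lam ^ t * E t (\<lambda>x. rew (fst x) (snd x)) + (a (Suc t) - a t) =
     lam ^ t * E t (\<lambda>x. rew (fst x) (snd x) + lam * measure_pmf.expectation (P (fst x) (snd x)) v - v (fst x))" for t
    unfolding E_def a_def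
    by (simp add: integrable_measure_pmf_finite algebra_simps)
  ultimately have "(\<lambda>t. lam ^ t * E t (\<lambda>x. rew (fst x) (snd x) + lam * measure_pmf.expectation (P (fst x) (snd x)) v - v (fst x)))
    sums (discounted_return rew p0 P \<pi> lam - measure_pmf.expectation p0 v)"
    by simp
  from sums_unique2[OF discounted_return_sums[OF lam] this[unfolded E_def]]
  show ?thesis .
qed

lemma discounted_return_mono:
  fixes p0 :: "'s :: finite pmf" and P :: "('s, 'a :: finite) kernel"
  assumes lam: "0 \<le> lam" "lam < 1"
    and le: "\<And>t x. x \<in> set_pmf (state_action_pmf p0 P \<pi> t) \<Longrightarrow> rew (fst x) (snd x) \<le> rew' (fst x) (snd x)"
  shows "discounted_return rew p0 P \<pi> lam \<le> discounted_return rew' p0 P \<pi> lam"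
  using lam(1) le
  by (intro sums_le[OF _ discounted_return_sums[OF lam] discounted_return_sums[OF lam]]
      mult_left_mono expectation_finite_le) auto

lemma discounted_return_zero:
  fixes p0 :: "'s :: finite pmf" and P :: "('s, 'a :: finite) kernel"
  assumes "0 \<le> lam" "lam < 1"
  shows "discounted_return (\<lambda>_ _. 0) p0 P \<pi> lam = 0"
  using discounted_return_sums[OF assms, of p0 P \<pi> "\<lambda>_ _. 0"] by (simp add: sums_iff)

lemma discounted_return_le_superharmonic:
  fixes p0 :: "'s :: finite pmf" and P :: "('s, 'a :: finite) kernel"
  assumes lam: "0 \<le> lam" "lam < 1"
    and v: "\<And>s a. rew s a + lam * measure_pmf.expectation (P s a) v \<le> v s"
  shows "discounted_return rew p0 P \<pi> lam \<le> measure_pmf.expectation p0 v"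
  using discounted_return_mono[OF lam, of p0 P \<pi> "\<lambda>s a. rew s a + lam * measure_pmf.expectation (P s a) v - v s" "\<lambda>_ _. 0"] v
  by (simp add: discounted_return_zero[OF lam] discounted_return_telescope[OF lam])

lemma discounted_return_ge_subharmonic:
  fixes p0 :: "'s :: finite pmf" and P :: "('s, 'a :: finite) kernel"
  assumes lam: "0 \<le> lam" "lam < 1"
    and v: "\<And>s. v s \<le> rew s (d s) + lam * measure_pmf.expectation (P s (d s)) v"
  shows "measure_pmf.expectation p0 v \<le> discounted_return rew p0 P (\<lambda>_ s. return_pmf (d s)) lam"
proof -
  let ?\<pi> = "\<lambda>_ s. return_pmf (d s)"
  have "snd x = d (fst x)" if "x \<in> set_pmf (state_action_pmf p0 P ?\<pi> t)" for x t
    using that by (auto simp: state_action_pmf_def next_pair_def)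
  then have "discounted_return (\<lambda>_ _. 0) p0 P ?\<pi> lam \<le>
      discounted_return (\<lambda>s a. rew s a + lam * measure_pmf.expectation (P s a) v - v s) p0 P ?\<pi> lam"
    using v by (intro discounted_return_mono[OF lam]) simp
  then show ?thesis
    by (simp add: discounted_return_zero[OF lam] discounted_return_telescope[OF lam])
qed

lemma continuous_on_pmf_bind:
  assumes "finite A" "\<And>x. set_pmf (M x) \<subseteq> A"
    and "\<And>y. continuous_on X (\<lambda>x. pmf (M x) y)"
    and "\<And>y. y \<in> A \<Longrightarrow> continuous_on X (\<lambda>x. pmf (N x y) z)"
  shows "continuous_on X (\<lambda>x. pmf (bind_pmf (M x) (N x)) z)"
proof -
  have "pmf (bind_pmf (M x) (N x)) z = (\<Sum>y\<in>A. pmf (M x) y * pmf (N x y) z)" for x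
    using assms(1,2) by (subst pmf_bind, subst integral_measure_pmf[of A]) auto
  then show ?thesis
    by (simp add: assms continuous_on_sum continuous_on_mult)
qed

lemma continuous_on_pmf_next_pair:
  fixes K :: "'x :: topological_space \<Rightarrow> ('s :: finite, 'a :: finite) kernel"
  assumes "\<And>s a s'. continuous_on X (\<lambda>x. pmf (K x s a) s')"
  shows "continuous_on X (\<lambda>x. pmf (next_pair p0 (K x) \<pi> h) z)"
  unfolding next_pair_def next_state_def
  by (cases "h = []") (auto intro!: continuous_on_pmf_bind[of UNIV] assms)

lemma continuous_on_pmf_history:
  fixes K :: "'x :: topological_space \<Rightarrow> ('s :: finite, 'a :: finite) kernel"
  assumes "\<And>s a s'. continuous_on X (\<lambda>x. pmf (K x s a) s')"
  shows "continuous_on X (\<lambda>x. pmf (history_pmf p0 (K x) \<pi> t) h)"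
proof (induction t arbitrary: h)
  case (Suc t)
  show ?case
    unfolding history_pmf.simps map_pmf_def
    by (intro continuous_on_pmf_bind[OF finite_histories set_pmf_history_subset Suc.IH]
        continuous_on_pmf_bind[of UNIV] continuous_on_pmf_next_pair assms) auto
qed simp

lemma continuous_on_discounted_return:
  fixes K :: "'x :: topological_space \<Rightarrow> ('s :: finite, 'a :: finite) kernel"
  assumes lam: "0 \<le> lam" "lam < 1"
    and K: "\<And>s a s'. continuous_on X (\<lambda>x. pmf (K x s a) s')"
  shows "continuous_on X (\<lambda>x. discounted_return rew p0 (K x) \<pi> lam)"
proof -
  let ?f = "\<lambda>x. rew (fst x) (snd x)"
  define g where "g t x = lam ^ t * measure_pmf.expectation (state_action_pmf p0 (K x) \<pi> t) ?f" for t x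
  obtain B where B: "\<And>x. \<bar>?f x\<bar> \<le> B"
    by (rule that[of "Max (range (\<lambda>x. \<bar>?f x\<bar>))"]) simp
  have "continuous_on X (\<lambda>x. pmf (state_action_pmf p0 (K x) \<pi> t) z)" for t z
    unfolding state_action_pmf_def
    by (intro continuous_on_pmf_bind[OF finite_histories set_pmf_history_subset]
        continuous_on_pmf_history continuous_on_pmf_next_pair K)
  then have cont: "continuous_on X (g t)" for t
    unfolding g_def by (simp add: integral_measure_pmf[of UNIV] continuous_intros)
  have bnd: "norm (g t x) \<le> lam ^ t * B" for t x
  proof -
    have "\<bar>measure_pmf.expectation (state_action_pmf p0 (K x) \<pi> t) ?f\<bar> \<le>
        measure_pmf.expectation (state_action_pmf p0 (K x) \<pi> t) (\<lambda>x. \<bar>?f x\<bar>)"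
      by (rule integral_abs_bound)
    also have "\<dots> \<le> measure_pmf.expectation (state_action_pmf p0 (K x) \<pi> t) (\<lambda>x. B)"
      by (rule expectation_finite_le) (rule B)
    finally show ?thesis using lam by (simp add: g_def abs_mult mult_left_mono)
  qed
  have "uniform_limit X (\<lambda>n x. \<Sum>t<n. g t x) (\<lambda>x. \<Sum>t. g t x) sequentially"
    using lam by (intro Weierstrass_m_test[OF bnd] summable_mult2 summable_geometric) simp
  then have "continuous_on X (\<lambda>x. \<Sum>t. g t x)"
    by (rule uniform_limit_theorem[rotated]) (auto intro!: always_eventually continuous_on_sum cont)
  then show ?thesis
    by (simp add: sums_unique[OF discounted_return_sums[OF lam]] g_def)
qed

subsection \<open>Saddle points\<close>

lemma compact_factor_set:
  assumes "\<And>i. compact (Ws i)"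
  shows "compact (factor_set Ws)"
proof -
  have "compactin (product_topology (\<lambda>i. euclidean) UNIV) (PiE UNIV Ws)"
    using assms by (simp add: compactin_PiE)
  moreover have "PiE UNIV Ws = factor_set Ws"
    by (auto simp: factor_set_def PiE_iff)
  ultimately show ?thesis
    by (simp add: euclidean_product_topology)
qed

lemma R_attains_min:
  fixes u :: "'r :: finite \<Rightarrow> 's :: finite \<Rightarrow> 'a :: finite \<Rightarrow> real"
  assumes rect: "r_rectangular u Ws \<P>" and lam: "0 \<le> lam" "lam < 1"
  shows "\<exists>W. is_arg_min (\<lambda>W. R rew p0 u \<pi> W lam) (\<lambda>W. W \<in> factor_set Ws) W"
proof -
  have "continuous_on (factor_set Ws) (\<lambda>W. \<Sum>i\<in>UNIV. u i s a * W i $ s')" for s a s'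
    by (intro continuous_intros continuous_on_subset[OF continuous_on_product_coordinates]) auto
  then have "continuous_on (factor_set Ws) (\<lambda>W. pmf (factor_kernel u W s a) s')" for s a s'
    by (subst continuous_on_cong[OF refl pmf_factor_kernel[OF rect]])
  then have "continuous_on (factor_set Ws) (\<lambda>W. R rew p0 u \<pi> W lam)"
    unfolding R_def by (intro continuous_on_discounted_return lam)
  moreover have "compact (factor_set Ws)" 
    using rect by (intro compact_factor_set) (auto simp: r_rectangular_def)
  moreover have "factor_set Ws \<noteq> {}"
  proof -
    have "\<exists>W. \<forall>i. W i \<in> Ws i"
      using rect by (intro choice) (auto simp: r_rectangular_def)
    then show ?thesis by (auto simp: factor_set_def)
  qed
  ultimately obtain W where "W \<in> factor_set Ws" "\<forall>W'\<in>factor_set Ws. R rew p0 u \<pi> W lam \<le> R rew p0 u \<pi> W' lam"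
    using continuous_attains_inf by blast
  then show ?thesis
    by (auto simp: is_arg_min_linorder)
qed

lemma expectation_factor_kernel:
  fixes u :: "'r :: finite \<Rightarrow> 's :: finite \<Rightarrow> 'a :: finite \<Rightarrow> real" and v :: "real ^ 's"
  assumes "r_rectangular u Ws \<P>" "W \<in> factor_set Ws"
  shows "measure_pmf.expectation (factor_kernel u W s a) (($) v) = (\<Sum>i\<in>UNIV. u i s a * (W i \<bullet> v))"
proof -
  have "measure_pmf.expectation (factor_kernel u W s a) (($) v) =
      (\<Sum>s'\<in>UNIV. (\<Sum>i\<in>UNIV. u i s a * W i $ s') * v $ s')"
    by (simp add: integral_measure_pmf[of UNIV] pmf_factor_kernel[OF assms])
  also have "\<dots> = (\<Sum>i\<in>UNIV. \<Sum>s'\<in>UNIV. u i s a * W i $ s' * v $ s')"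
    by (subst sum.swap) (simp add: sum_distrib_right)
  finally show ?thesis
    by (simp add: inner_vec_def sum_distrib_left mult.assoc)
qed

lemma robust_optimalI:
  fixes u :: "'r :: finite \<Rightarrow> 's :: finite \<Rightarrow> 'a :: finite \<Rightarrow> real" and v :: "real ^ 's"
  assumes rect: "r_rectangular u Ws \<P>" and lam: "0 \<le> lam" "lam < 1"
    and W: "W \<in> factor_set Ws"
    and v_eq: "\<And>s. v $ s = rew s (d s) + lam * (\<Sum>i\<in>UNIV. u i s (d s) * (W i \<bullet> v))"
    and v_ge: "\<And>s a. rew s a + lam * (\<Sum>i\<in>UNIV. u i s a * (W i \<bullet> v)) \<le> v $ s"
    and W_le: "\<And>i w. w \<in> Ws i \<Longrightarrow> W i \<bullet> v \<le> w \<bullet> v"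
  shows "robust_optimal rew p0 u (factor_set Ws) lam (\<lambda>_ s. return_pmf (d s)) W"
proof -
  let ?\<pi> = "\<lambda>_ s. return_pmf (d s)" and ?V = "measure_pmf.expectation p0 (($) v)"
  note ex = expectation_factor_kernel[OF rect]
  have u: "0 \<le> u i s a" for i s a
    using rect by (simp add: r_rectangular_def)
  have upper: "R rew p0 u \<pi> W lam \<le> ?V" for \<pi>
    unfolding R_def using v_ge by (intro discounted_return_le_superharmonic lam) (simp add: ex W)
  have lower: "?V \<le> R rew p0 u ?\<pi> W' lam" if W': "W' \<in> factor_set Ws" for W'
    unfolding R_def
  proof (rule discounted_return_ge_subharmonic[OF lam])
    fix s
    have "(\<Sum>i\<in>UNIV. u i s (d s) * (W i \<bullet> v)) \<le> (\<Sum>i\<in>UNIV. u i s (d s) * (W' i \<bullet> v))"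
      using W' by (intro sum_mono mult_left_mono u W_le) (auto simp: factor_set_def)
    then show "v $ s \<le> rew s (d s) + lam * measure_pmf.expectation (factor_kernel u W' s (d s)) (($) v)"
      using lam(1) by (simp add: ex W' v_eq[of s] mult_left_mono)
  qed
  have min: "\<exists>W. is_arg_min (\<lambda>W. R rew p0 u \<pi> W lam) (\<lambda>W. W \<in> factor_set Ws) W" for \<pi>
    by (rule R_attains_min[OF rect lam])
  have inf_le: "(INF W\<in>factor_set Ws. R rew p0 u \<pi> W lam) \<le> ?V" for \<pi>
  proof -
    have "bdd_below ((\<lambda>W. R rew p0 u \<pi> W lam) ` factor_set Ws)"
      using min[of \<pi>] by (auto simp: is_arg_min_linorder intro: bdd_belowI2)
    then show ?thesis
      by (rule cINF_lower2[where x=W]) (rule W, rule upper)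
  qed
  have "?V \<le> (INF W\<in>factor_set Ws. R rew p0 u ?\<pi> W lam)"
    using W lower by (intro cINF_greatest) auto
  then have "is_arg_max (\<lambda>\<pi>. INF W\<in>factor_set Ws. R rew p0 u \<pi> W lam) (\<lambda>_. True) ?\<pi>"
    using inf_le by (auto simp: is_arg_max_linorder intro: order_trans)
  moreover have "is_arg_min (\<lambda>W. R rew p0 u ?\<pi> W lam) (\<lambda>W. W \<in> factor_set Ws) W"
    using W lower upper by (auto simp: is_arg_min_linorder intro: order_trans)
  ultimately show ?thesis
    using min by (simp add: robust_optimal_def attains_max_min_def)
qed

lemma monotone_fixpoint_exists:
  fixes T :: "('s \<Rightarrow> real) \<Rightarrow> 's \<Rightarrow> real"
  assumes mono: "\<And>f g. f \<le> g \<Longrightarrow> T f \<le> T g" and a: "a \<le> T a" and b: "T b \<le> b" and ab: "a \<le> b"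
  shows "\<exists>f. T f = f"
proof -
  define F where "F = {f. f \<le> b \<and> f \<le> T f}"
  define g where "g s = (SUP f\<in>F. f s)" for s
  have bdd: "bdd_above ((\<lambda>f. f s) ` F)" for s
    by (rule bdd_aboveI2[of _ _ "b s"]) (auto simp: F_def le_fun_def)
  have F_ne: "F \<noteq> {}"
    using a ab by (auto simp: F_def)
  have upper: "f \<le> g" if "f \<in> F" for f
    unfolding le_fun_def g_def using cSUP_upper[OF that bdd] by blast
  have least: "g \<le> h" if "\<And>f. f \<in> F \<Longrightarrow> f \<le> h" for h
    unfolding le_fun_def g_def using F_ne that by (intro allI cSUP_least) (simp_all add: le_fun_def)
  have "g \<le> T g"
  proof (rule least)
    fix f assume f: "f \<in> F"
    then have "f \<le> T f" by (simp add: F_def)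
    also have "\<dots> \<le> T g" by (rule mono[OF upper[OF f]])
    finally show "f \<le> T g" .
  qed
  moreover have "g \<le> b"
    by (rule least) (simp add: F_def)
  ultimately have "T g \<in> F"
    using mono[of g "T g"] order_trans[OF mono[of g b] b] by (simp add: F_def)
  then have "T g \<le> g" by (rule upper)
  with \<open>g \<le> T g\<close> show ?thesis by (intro exI antisym)
qed

definition bellman_pair ::
  "('s :: finite \<Rightarrow> 'a \<Rightarrow> real) \<Rightarrow> ('r :: finite \<Rightarrow> 's \<Rightarrow> 'a \<Rightarrow> real) \<Rightarrow> ('r \<Rightarrow> (real ^ 's) set) \<Rightarrow>
    real \<Rightarrow> ('s \<Rightarrow> 'a) \<Rightarrow> ('s, 'r) factor \<Rightarrow> bool" where
  "bellman_pair rew u Ws lam d W \<longleftrightarrow> (\<exists>v.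
     (\<forall>s. v $ s = rew s (d s) + lam * (\<Sum>i\<in>UNIV. u i s (d s) * (W i \<bullet> v))) \<and>
     (\<forall>s a. rew s a + lam * (\<Sum>i\<in>UNIV. u i s a * (W i \<bullet> v)) \<le> v $ s) \<and>
     (\<forall>i. \<forall>w\<in>Ws i. W i \<bullet> v \<le> w \<bullet> v))"

lemma prob_vector_inner_mono:
  assumes "w \<in> prob_vectors" "\<And>s. f s \<le> g s"
  shows "w \<bullet> (\<chi> s. f s) \<le> w \<bullet> (\<chi> s. g s)"
  using assms by (auto simp: prob_vectors_def inner_vec_def intro!: sum_mono mult_left_mono)

lemma prob_vector_inner_const:
  assumes "w \<in> prob_vectors"
  shows "w \<bullet> (\<chi> s. c) = c"
  using assms by (simp add: prob_vectors_def inner_vec_def sum_distrib_right[symmetric])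

lemma bellman_pair_exists:
  fixes rew :: "'s :: finite \<Rightarrow> 'a :: finite \<Rightarrow> real" and u :: "'r :: finite \<Rightarrow> 's \<Rightarrow> 'a \<Rightarrow> real"
  assumes u: "\<And>i s a. 0 \<le> u i s a" "\<And>s a. (\<Sum>i\<in>UNIV. u i s a) = 1"
    and E: "\<And>i. finite (E i)" "\<And>i. E i \<noteq> {}" "\<And>i. E i \<subseteq> prob_vectors"
    and lam: "0 \<le> lam" "lam < 1"
  shows "\<exists>d W. W \<in> factor_set E \<and> bellman_pair rew u E lam d W"
proof -
  define m where "m i v = Min ((\<lambda>w. w \<bullet> v) ` E i)" for i v
  define q where "q v s a = rew s a + lam * (\<Sum>i\<in>UNIV. u i s a * m i v)" for v s a
  define T where "T f s = Max (range (q (\<chi> s. f s) s))" for f s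
  have m_le: "m i v \<le> w \<bullet> v" if "w \<in> E i" for i v w
    using that E by (simp add: m_def)
  have m_in: "\<exists>w\<in>E i. m i v = w \<bullet> v" for i v
  proof -
    have "m i v \<in> (\<lambda>w. w \<bullet> v) ` E i"
      unfolding m_def using E by (intro Min_in) auto
    then show ?thesis by auto
  qed
  have T_in: "\<exists>a. T f s = q (\<chi> s. f s) s a" for f s
  proof -
    have "T f s \<in> range (q (\<chi> s. f s) s)"
      unfolding T_def by (intro Max_in) auto
    then show ?thesis by auto
  qed
  have q_le: "q (\<chi> s. f s) s a \<le> T f s" for f s a
    by (simp add: T_def)
  have m_mono: "m i (\<chi> s. f s) \<le> m i (\<chi> s. g s)" if "f \<le> g" for i f g
  proof -
    obtain w where "w \<in> E i" "m i (\<chi> s. g s) = w \<bullet> (\<chi> s. g s)" using m_in by blast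
    moreover have "w \<bullet> (\<chi> s. f s) \<le> w \<bullet> (\<chi> s. g s)"
      using that E(3)[of i] \<open>w \<in> E i\<close> by (intro prob_vector_inner_mono) (auto simp: le_fun_def)
    ultimately show ?thesis using m_le[of w i "\<chi> s. f s"] by simp
  qed
  have q_mono: "q (\<chi> s. f s) s a \<le> q (\<chi> s. g s) s a" if "f \<le> g" for f g s a
    using lam u m_mono[OF that] by (auto simp: q_def intro!: mult_left_mono sum_mono)
  have "m i (\<chi> s. c) = c" for i c
    using m_in[of i "\<chi> s. c"] E(3)[of i] by (auto simp: prob_vector_inner_const)
  then have q_const: "q (\<chi> s. c) s a = rew s a + lam * c" for c s a
    using u by (simp add: q_def sum_distrib_right[symmetric])
  obtain B where B: "\<And>s a. \<bar>rew s a\<bar> \<le> B"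
  proof
    show "\<bar>rew s a\<bar> \<le> Max (range (\<lambda>x. \<bar>rew (fst x) (snd x)\<bar>))" for s a
      by (intro Max_ge) (auto intro: rev_image_eqI[of "(s, a)"])
  qed
  have B0: "0 \<le> B" using B[of undefined undefined] by linarith
  define b where "b = B / (1 - lam)"
  have b: "B + lam * b = b" using lam by (simp add: b_def field_simps)
  have b0: "0 \<le> b" using B0 lam by (simp add: b_def)
  have "\<exists>f. T f = f"
  proof (rule monotone_fixpoint_exists)
    fix f g :: "'s \<Rightarrow> real" assume "f \<le> g"
    show "T f \<le> T g"
    proof (rule le_funI)
      fix s
      obtain a where "T f s = q (\<chi> s. f s) s a" using T_in by blast
      then show "T f s \<le> T g s"
        using q_mono[OF \<open>f \<le> g\<close>, of s a] q_le[of g s a] by linarith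
    qed
  next
    show "(\<lambda>s. - b) \<le> T (\<lambda>s. - b)"
    proof (rule le_funI)
      fix s
      show "- b \<le> T (\<lambda>s. - b) s"
        using q_le[of "\<lambda>s. - b" s undefined] B[of s undefined] b by (simp add: q_const)
    qed
  next
    show "T (\<lambda>s. b) \<le> (\<lambda>s. b)"
    proof (rule le_funI)
      fix s
      obtain a where "T (\<lambda>s. b) s = q (\<chi> s. b) s a" using T_in by blast
      then show "T (\<lambda>s. b) s \<le> b"
        using B[of s a] b by (simp add: q_const)
    qed
  next
    show "(\<lambda>s. - b) \<le> (\<lambda>s. b)" using b0 by (simp add: le_fun_def)
  qed
  then obtain f where f: "T f = f" ..
  let ?v = "\<chi> s. f s"
  obtain d where d: "\<And>s. T f s = q ?v s (d s)" using T_in[of f] by metis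
  obtain W where W: "\<And>i. W i \<in> E i" "\<And>i. m i ?v = W i \<bullet> ?v" using m_in[of _ ?v] by metis
  have "bellman_pair rew u E lam d W"
    unfolding bellman_pair_def
  proof (intro exI[of _ ?v] conjI allI ballI)
    fix s show "?v $ s = rew s (d s) + lam * (\<Sum>i\<in>UNIV. u i s (d s) * (W i \<bullet> ?v))"
      using d[of s] f by (simp add: q_def W(2))
    fix a show "rew s a + lam * (\<Sum>i\<in>UNIV. u i s a * (W i \<bullet> ?v)) \<le> ?v $ s"
      using q_le[of f s a] f by (simp add: q_def W(2))
  next
    fix i w assume "w \<in> E i"
    then show "W i \<bullet> ?v \<le> w \<bullet> ?v" using m_le W(2) by metis
  qed
  then show ?thesis using W(1) by (auto simp: factor_set_def)
qed

subsection \<open>Discount factors close to one\<close>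

definition eventually_decided :: "('x \<Rightarrow> bool) \<Rightarrow> 'x filter \<Rightarrow> bool" where
  "eventually_decided P F \<longleftrightarrow> eventually P F \<or> (\<forall>\<^sub>F x in F. \<not> P x)"

lemma eventually_decided_conj:
  assumes "eventually_decided P F" "eventually_decided Q F"
  shows "eventually_decided (\<lambda>x. P x \<and> Q x) F"
proof -
  consider "eventually P F" "eventually Q F" | "\<forall>\<^sub>F x in F. \<not> P x" | "\<forall>\<^sub>F x in F. \<not> Q x"
    using assms unfolding eventually_decided_def by blast
  then show ?thesis
  proof cases
    case 1
    then show ?thesis by (simp add: eventually_decided_def eventually_conj)
  qed (unfold eventually_decided_def, (rule disjI2, erule eventually_mono, simp)+)
qed

lemma eventually_decided_ball:
  assumes "finite A" "\<And>a. a \<in> A \<Longrightarrow> eventually_decided (\<lambda>x. P x a) F"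
  shows "eventually_decided (\<lambda>x. \<forall>a\<in>A. P x a) F"
  using assms
proof (induction A rule: finite_induct)
  case empty
  show ?case by (simp add: eventually_decided_def)
next
  case (insert a A)
  then show ?case by (simp add: eventually_decided_conj)
qed

lemma eventually_decided_all:
  fixes P :: "'x \<Rightarrow> 'b :: finite \<Rightarrow> bool"
  assumes "\<And>a. eventually_decided (\<lambda>x. P x a) F"
  shows "eventually_decided (\<lambda>x. \<forall>a. P x a) F"
  using eventually_decided_ball[of UNIV P F] assms by simp

lemma eventually_decided_cong:
  assumes "\<forall>\<^sub>F x in F. P x \<longleftrightarrow> Q x" "eventually_decided Q F"
  shows "eventually_decided P F"
  using assms(2) eventually_subst[OF assms(1)]
    eventually_subst[of "\<lambda>x. \<not> P x" "\<lambda>x. \<not> Q x" F] assms(1)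
  unfolding eventually_decided_def by simp

lemma real_polynomial_function_sign_at_left:
  fixes f :: "real \<Rightarrow> real"
  assumes f: "real_polynomial_function f" and ne: "f z \<noteq> 0"
  shows "(\<forall>\<^sub>F x in at_left c. f x > 0) \<or> (\<forall>\<^sub>F x in at_left c. f x < 0)"
proof -
  obtain a n where fs: "f = (\<lambda>x. \<Sum>i\<le>n. a i * x ^ i)"
    using f by (auto simp: real_polynomial_function_iff_sum)
  have "\<exists>i\<le>n. a i \<noteq> 0"
    using ne fs by (metis (no_types, lifting) atMost_iff mult_zero_left sum.neutral)
  then have fin: "finite {x. f x = 0}"
    unfolding fs by (simp add: polyfun_finite_roots)
  define b where "b = Max (insert (c - 1) ({x. f x = 0} \<inter> {..<c}))"
  have b: "b < c"
    unfolding b_def using fin by (subst Max_less_iff) auto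
  have nz: "f x \<noteq> 0" if "b < x" "x < c" for x
  proof
    assume "f x = 0"
    then have "x \<le> b" unfolding b_def using fin that by (intro Max_ge) auto
    then show False using that by simp
  qed
  have "connected (f ` {b<..<c})"
    using continuous_real_polymonial_function[OF f]
    by (intro connected_continuous_image continuous_at_imp_continuous_on) auto
  then have "\<not> (f x \<le> 0 \<and> 0 \<le> f y)" if "x \<in> {b<..<c}" "y \<in> {b<..<c}" for x y
    using connectedD_interval[of "f ` {b<..<c}" "f x" "f y" 0] that nz by fastforce
  then have "(\<forall>x\<in>{b<..<c}. f x > 0) \<or> (\<forall>x\<in>{b<..<c}. f x < 0)"
    by (meson linorder_le_less_linear less_imp_le)
  then show ?thesis
    using b by (auto simp: eventually_at_left_field)
qed

lemma eventually_decided_real_polynomial_le: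
  fixes f g :: "real \<Rightarrow> real"
  assumes "real_polynomial_function f" "real_polynomial_function g"
  shows "eventually_decided (\<lambda>x. f x \<le> g x) (at_left c)"
proof (cases "\<exists>z. g z - f z \<noteq> 0")
  case True
  then obtain z where z: "g z - f z \<noteq> 0" ..
  have "real_polynomial_function (\<lambda>x. g x - f x)"
    using assms by (intro real_polynomial_function_diff)
  from real_polynomial_function_sign_at_left[of _ z c, OF this z]
  show ?thesis
    unfolding eventually_decided_def by (elim disj_forward) (simp_all add: less_imp_le not_le eventually_mono)
next
  case False
  then show ?thesis by (simp add: eventually_decided_def)
qed

lemma real_polynomial_function_det:
  fixes M :: "real \<Rightarrow> real ^ 'n ^ 'n"
  assumes "\<And>i j. real_polynomial_function (\<lambda>x. M x $ i $ j)"
  shows "real_polynomial_function (\<lambda>x. det (M x))"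
  unfolding det_def
  by (intro real_polynomial_function_sum real_polynomial_function_prod real_polynomial_function.intros(4)
      real_polynomial_function.intros(2) assms finite_permutations) auto

lemma eventually_decided_bellman_pair:
  fixes rew :: "'s :: finite \<Rightarrow> 'a :: finite \<Rightarrow> real" and u :: "'r :: finite \<Rightarrow> 's \<Rightarrow> 'a \<Rightarrow> real"
  assumes E: "\<And>i. finite (E i)"
  shows "eventually_decided (\<lambda>lam. bellman_pair rew u E lam d W) (at_left c)"
proof -
  define A :: "real \<Rightarrow> real ^ 's ^ 's" where
    "A lam = (\<chi> s s'. (if s = s' then 1 else 0) - lam * (\<Sum>i\<in>UNIV. u i s (d s) * W i $ s'))" for lam
  define N :: "real \<Rightarrow> real ^ 's" where
    "N lam = (\<chi> k. det (\<chi> i j. if j = k then rew i (d i) else A lam $ i $ j))" for lam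
  define D where "D lam = det (A lam)" for lam
  have id: "real_polynomial_function (\<lambda>x. x)"
    by (rule real_polynomial_function.intros(1)) (rule bounded_linear_ident)
  have pA: "real_polynomial_function (\<lambda>lam. A lam $ i $ j)" for i j
    unfolding A_def by (auto intro!: real_polynomial_function_diff real_polynomial_function.intros(4) id real_polynomial_function.intros(2))
  have pD: "real_polynomial_function D"
    unfolding D_def[abs_def] by (intro real_polynomial_function_det pA)
  have pN: "real_polynomial_function (\<lambda>lam. N lam $ k)" for k
    unfolding N_def vec_lambda_beta
    by (intro real_polynomial_function_det, case_tac "j = k")
      (simp_all add: pA real_polynomial_function.intros(2))
  have pI: "real_polynomial_function (\<lambda>lam. w \<bullet> N lam)" for w
    unfolding inner_vec_def by (auto intro!: real_polynomial_function_sum real_polynomial_function.intros(4) pN real_polynomial_function.intros(2))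
  have "A 0 = mat 1" by (simp add: A_def mat_def)
  then have "D 0 \<noteq> 0" by (simp add: D_def)
  then have D: "\<forall>\<^sub>F lam in at_left c. D lam \<noteq> 0"
    using real_polynomial_function_sign_at_left[OF pD, of 0 c] by (auto elim: eventually_mono)
  have sol: "(\<forall>s. v $ s = rew s (d s) + lam * (\<Sum>i\<in>UNIV. u i s (d s) * (W i \<bullet> v))) \<longleftrightarrow>
      v = (1 / D lam) *\<^sub>R N lam" if "D lam \<noteq> 0" for v lam
  proof -
    have "(A lam *v v) $ s = v $ s - lam * (\<Sum>i\<in>UNIV. u i s (d s) * (W i \<bullet> v))" for s
    proof -
      let ?p = "\<lambda>s'. \<Sum>i\<in>UNIV. u i s (d s) * W i $ s'"
      have "(A lam *v v) $ s = (\<Sum>s'\<in>UNIV. (if s = s' then v $ s' else 0) - lam * (?p s' * v $ s'))"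
        unfolding matrix_vector_mult_def A_def vec_lambda_beta
        by (intro sum.cong) (simp_all add: left_diff_distrib)
      also have "\<dots> = v $ s - lam * (\<Sum>s'\<in>UNIV. ?p s' * v $ s')"
        by (simp add: sum_subtractf sum_distrib_left[symmetric])
      also have "(\<Sum>s'\<in>UNIV. (\<Sum>i\<in>UNIV. u i s (d s) * W i $ s') * v $ s') = (\<Sum>i\<in>UNIV. u i s (d s) * (W i \<bullet> v))"
        unfolding sum_distrib_right by (subst sum.swap) (simp add: inner_vec_def sum_distrib_left mult.assoc)
      finally show ?thesis .
    qed
    then have "A lam *v v = (\<chi> s. rew s (d s)) \<longleftrightarrow>
        (\<forall>s. v $ s = rew s (d s) + lam * (\<Sum>i\<in>UNIV. u i s (d s) * (W i \<bullet> v)))"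
      by (auto simp: vec_eq_iff algebra_simps)
    moreover have "(\<chi> k. det (\<chi> i j. if j = k then (\<chi> s. rew s (d s)) $ i else A lam $ i $ j) / det (A lam)) = (1 / D lam) *\<^sub>R N lam"
      by (simp add: vec_eq_iff N_def D_def cong: if_cong)
    ultimately show ?thesis
      using cramer[of "A lam" v "\<chi> s. rew s (d s)"] that by (simp add: D_def)
  qed
  let ?Q = "\<lambda>lam. (\<forall>s a. rew s a * (D lam * D lam) + lam * (\<Sum>i\<in>UNIV. u i s a * (W i \<bullet> N lam)) * D lam \<le> N lam $ s * D lam) \<and>
     (\<forall>i. \<forall>w\<in>E i. (W i \<bullet> N lam) * D lam \<le> (w \<bullet> N lam) * D lam)"
  have "eventually_decided ?Q (at_left c)"
    by (intro eventually_decided_conj eventually_decided_all eventually_decided_ball E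
        eventually_decided_real_polynomial_le real_polynomial_function.intros(3) real_polynomial_function.intros(4)
        real_polynomial_function_sum real_polynomial_function.intros(2) id pD pN pI finite)
  moreover have "\<forall>\<^sub>F lam in at_left c. bellman_pair rew u E lam d W \<longleftrightarrow> ?Q lam"
    using D
  proof eventually_elim
    case (elim lam)
    have scale: "x / D lam \<le> y / D lam \<longleftrightarrow> x * D lam \<le> y * D lam" for x y
      using elim by (auto simp: divide_le_cancel mult_le_cancel_right)
    have "rew s a + lam * (\<Sum>i\<in>UNIV. u i s a * (W i \<bullet> (1 / D lam) *\<^sub>R N lam)) =
       (rew s a * D lam + lam * (\<Sum>i\<in>UNIV. u i s a * (W i \<bullet> N lam))) / D lam" for s a
      using elim by (simp add: sum_divide_distrib[symmetric] add_divide_distrib)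
    then show ?case
      unfolding bellman_pair_def using elim
      by (simp add: sol scale distrib_right mult.assoc)
  qed
  ultimately show ?thesis
    by (rule eventually_decided_cong[rotated])
qed

lemma extreme_points_inner_le:
  fixes S :: "'x :: euclidean_space set"
  assumes "compact S" "convex S" "w \<in> S" "\<And>e. e extreme_point_of S \<Longrightarrow> c \<le> e \<bullet> v"
  shows "c \<le> w \<bullet> v"
proof -
  have "convex hull {e. e extreme_point_of S} \<subseteq> {x. v \<bullet> x \<ge> c}"
    using assms(4) by (intro hull_minimal convex_halfspace_ge) (auto simp: inner_commute)
  then show ?thesis
    using assms Krein_Milman_Minkowski[of S] by (auto simp: inner_commute)
qed

theorem proposition6p2:
  fixes rew :: "'s :: finite \<Rightarrow> 'a :: finite \<Rightarrow> real"
    and p0 :: "'s pmf"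
    and u :: "'r :: finite \<Rightarrow> 's \<Rightarrow> 'a \<Rightarrow> real"
    and Ws :: "'r \<Rightarrow> (real ^ 's) set"
    and \<P> :: "('s, 'a) kernel set"
  assumes "\<And>s a. 0 \<le> rew s a"
    and "r_rectangular u Ws \<P>"
    and "\<And>i. finite {w. w extreme_point_of (Ws i)}"
  shows "\<exists>(\<pi>\<^sub>0 :: ('s, 'a) policy) W\<^sub>0 lam\<^sub>0.
    stationary \<pi>\<^sub>0 \<and> deterministic \<pi>\<^sub>0 \<and> W\<^sub>0 \<in> factor_set Ws \<and> 0 < lam\<^sub>0 \<and> lam\<^sub>0 < 1 \<and>
    (\<forall>lam. lam\<^sub>0 < lam \<and> lam < 1 \<longrightarrow> robust_optimal rew p0 u (factor_set Ws) lam \<pi>\<^sub>0 W\<^sub>0)"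
proof -
  define E where "E i = {w. w extreme_point_of (Ws i)}" for i
  have u: "\<And>i s a. 0 \<le> u i s a" "\<And>s a. (\<Sum>i\<in>UNIV. u i s a) = 1"
    and Ws: "\<And>i. Ws i \<noteq> {}" "\<And>i. convex (Ws i)" "\<And>i. compact (Ws i)" "\<And>i. Ws i \<subseteq> prob_vectors"
    using assms(2) by (auto simp: r_rectangular_def)
  have fin: "finite (E i)" for i
    using assms(3) by (simp add: E_def)
  have E_sub: "E i \<subseteq> Ws i" for i
    by (auto simp: E_def extreme_point_of_def)
  have E_ne: "E i \<noteq> {}" for i
    using Krein_Milman_Minkowski[OF Ws(3,2), of i] Ws(1)[of i] by (auto simp: E_def)
  let ?G = "UNIV \<times> factor_set E :: (('s \<Rightarrow> 'a) \<times> ('s, 'r) factor) set"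
  let ?B = "\<lambda>lam dW. bellman_pair rew u E lam (fst dW) (snd dW)"
  have "factor_set E = PiE UNIV E"
    by (auto simp: factor_set_def PiE_iff)
  then have finG: "finite ?G"
    using fin by (simp add: finite_PiE)
  have "\<exists>dW\<in>?G. \<forall>\<^sub>F lam in at_left 1. ?B lam dW"
  proof (rule ccontr)
    assume "\<not> ?thesis"
    then have "\<forall>dW\<in>?G. \<forall>\<^sub>F lam in at_left 1. \<not> ?B lam dW"
      using eventually_decided_bellman_pair[of E, OF fin] unfolding eventually_decided_def by blast
    then have "\<forall>\<^sub>F lam in at_left 1. \<forall>dW\<in>?G. \<not> ?B lam dW"
      by (rule eventually_ball_finite[OF finG])
    moreover have "\<forall>\<^sub>F lam in at_left (1::real). lam \<in> {0<..<1}"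
      by (rule eventually_at_left_real) simp
    ultimately have "\<forall>\<^sub>F lam in at_left (1::real). False"
    proof eventually_elim
      case (elim lam)
      have "\<exists>d W. W \<in> factor_set E \<and> bellman_pair rew u E lam d W"
        using elim(2) E_sub Ws(4) by (intro bellman_pair_exists u fin E_ne order_trans[OF E_sub Ws(4)]) auto
      then show ?case using elim(1) by force
    qed
    then show False by simp
  qed
  then obtain d W where W: "W \<in> factor_set E" and ev: "\<forall>\<^sub>F lam in at_left 1. bellman_pair rew u E lam d W"
    by auto
  then obtain b where b: "b < 1" "\<And>lam. b < lam \<Longrightarrow> lam < 1 \<Longrightarrow> bellman_pair rew u E lam d W"
    by (auto simp: eventually_at_left_field)
  have W': "W \<in> factor_set Ws"
    using W E_sub by (auto simp: factor_set_def)
  let ?\<pi> = "\<lambda>_ s. return_pmf (d s)"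
  have opt: "robust_optimal rew p0 u (factor_set Ws) lam ?\<pi> W" if lam: "max b (1/2) < lam" "lam < 1" for lam
  proof -
    have "b < lam" using lam by simp
    from b(2)[OF this lam(2)] obtain v
      where v_eq: "\<forall>s. v $ s = rew s (d s) + lam * (\<Sum>i\<in>UNIV. u i s (d s) * (W i \<bullet> v))"
        and v_ge: "\<forall>s a. rew s a + lam * (\<Sum>i\<in>UNIV. u i s a * (W i \<bullet> v)) \<le> v $ s"
        and W_le: "\<forall>i. \<forall>w\<in>E i. W i \<bullet> v \<le> w \<bullet> v"
      unfolding bellman_pair_def by (elim exE conjE)
    show ?thesis
    proof (rule robust_optimalI[OF assms(2) _ lam(2) W' v_eq[rule_format] v_ge[rule_format]])
      show "0 \<le> lam" using lam by simp
      fix i w assume "w \<in> Ws i"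
      then show "W i \<bullet> v \<le> w \<bullet> v"
        by (rule extreme_points_inner_le[OF Ws(3,2)]) (use W_le in \<open>auto simp: E_def\<close>)
    qed
  qed
  have "stationary ?\<pi>"
    unfolding stationary_def by (intro exI[of _ "\<lambda>s. return_pmf (d s)"] allI refl)
  moreover have "deterministic ?\<pi>"
    unfolding deterministic_def by (metis pmf_return indicator_simps(1) singletonI)
  moreover have "0 < max b (1/2)" "max b (1/2) < 1"
    using b(1) by simp_all
  ultimately show ?thesis
    using W' opt by (intro exI[of _ ?\<pi>] exI[of _ W] exI[of _ "max b (1/2)"] conjI allI impI) simp_all
qed

end
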